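(* No nondegenerate regular continuum is $\omega$-sac.
   Context: A continuum is a compact connected metric space; it is nondegenerate if it has more than one point. A continuum is regular if it has a base (of open sets) all of whose elements have finite boundary. An arc in a space $X$ is a homeomorphic embedding $\alpha:[0,1]\to X$ (or its image). A topological space $X$ is $n$-strongly arc connected ($n$-sac) if for every $n$ distinct points $x_1,\dots,x_n$ of $X$ there are an arc $\alpha:[0,1]\to X$ and $t_1<t_2<\dots<t_n$ in $[0,1]$ such that $\alpha(t_i)=x_i$ for $i=1,\dots,n$. It is $\omega$-sac if it is $n$-sac for every integer $n\geq 2$. *)

theory Defs
  imports "HOL-Analysis.Analysis"
begin

definition is_base :: "'a topology \<Rightarrow> 'a set set \<Rightarrow> bool" where
  "is_base X \<B> \<longleftrightarrow>
     (\<forall>B\<in>\<B>. openin X B) \<and> (\<forall>U. openin X U \<longrightarrow> (\<exists>\<B>'\<subseteq>\<B>. \<Union>\<B>' = U))"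

definition continuum :: "'a metric \<Rightarrow> bool" where
  "continuum M \<longleftrightarrow> compact_space (mtopology_of M) \<and> connected_space (mtopology_of M)"

definition nondegenerate :: "'a metric \<Rightarrow> bool" where
  "nondegenerate M \<longleftrightarrow> (\<exists>x\<in>mspace M. \<exists>y\<in>mspace M. x \<noteq> y)"

definition regular_continuum :: "'a metric \<Rightarrow> bool" where
  "regular_continuum M \<longleftrightarrow>
     continuum M \<and>
     (\<exists>\<B>. is_base (mtopology_of M) \<B> \<and> (\<forall>B\<in>\<B>. finite (mtopology_of M frontier_of B)))"

text \<open>The library's \<^const>\<open>arc\<close> lives on topological-space types; on an abstract topology an arc
  is a homeomorphic embedding of the unit interval.\<close>

definition arc_in :: "'a topology \<Rightarrow> (real \<Rightarrow> 'a) \<Rightarrow> bool" where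
  "arc_in X \<alpha> \<longleftrightarrow> embedding_map (top_of_set {0..1}) X \<alpha>"

definition n_sac :: "nat \<Rightarrow> 'a topology \<Rightarrow> bool" where
  "n_sac n X \<longleftrightarrow>
     (\<forall>x :: nat \<Rightarrow> 'a. x ` {1..n} \<subseteq> topspace X \<and> inj_on x {1..n} \<longrightarrow>
        (\<exists>\<alpha> (t :: nat \<Rightarrow> real). arc_in X \<alpha> \<and> t ` {1..n} \<subseteq> {0..1} \<and>
           strict_mono_on {1..n} t \<and> (\<forall>i\<in>{1..n}. \<alpha> (t i) = x i)))"

definition omega_sac :: "'a topology \<Rightarrow> bool" where
  "omega_sac X \<longleftrightarrow> (\<forall>n\<ge>2. n_sac n X)"

end

theory Submission
  imports Defs
begin

text \<open>Let \<open>U\<close> be a member of the base which is not empty and not dense, such as one that contains a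
  point and misses a neighbourhood of another point. An arc that runs from \<open>U\<close> to
  the complement of the closure of \<open>U\<close>, or back, must pass through the boundary of \<open>U\<close> strictly in
  between (\<open>arc_in_crosses_frontier\<close>). An arc is injective, so an arc that alternates often enough
  between the two open sets meets the boundary in more points than the boundary contains
  (\<open>not_n_sac_if_finite_frontier\<close>). Such an arc exists in an \<open>\<omega>\<close>-sac space as soon as both open sets
  have enough points to alternate between, and they do: by connectedness, they are infinite
  (\<open>infinite_openin_connected_t1\<close>).\<close>

text \<open>A finite set in a \<open>T\<^sub>1\<close> space is closed, so a finite open set would separate the space.\<close>

lemma infinite_openin_connected_t1:
  assumes "connected_space X" "t1_space X" "openin X U" "U \<noteq> {}" "U \<noteq> topspace X"
  shows "infinite U"
proof
  assume "finite U"
  then have "closedin X U"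
    using assms(2) openin_subset[OF assms(3)] by (simp add: t1_space_closedin_finite)
  then show False
    using assms connected_space_clopen_in[of X] by metis
qed

text \<open>The crossing lies in the open parameter interval because neither endpoint is in the
  boundary; this is what makes crossings over adjacent intervals distinct.\<close>

lemma arc_in_crosses_frontier:
  assumes arc: "arc_in X \<alpha>" and st: "0 \<le> s" "s < t" "t \<le> 1"
    and U: "openin X U"
    and ends: "\<alpha> s \<in> U \<and> \<alpha> t \<in> topspace X - X closure_of U \<or>
               \<alpha> t \<in> U \<and> \<alpha> s \<in> topspace X - X closure_of U"
  shows "\<exists>r. s < r \<and> r < t \<and> \<alpha> r \<in> X frontier_of U"
proof -
  have cont: "continuous_map (top_of_set {0..1}) X \<alpha>"
    using arc homeomorphic_imp_continuous_map
    by (fastforce simp: arc_in_def embedding_map_def continuous_map_in_subtopology)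
  have "connectedin (top_of_set {0..1}) {s..t}"
    using st by (auto simp: connectedin_subtopology)
  then have conn: "connectedin X (\<alpha> ` {s..t})"
    by (rule connectedin_continuous_map_image[OF cont])
  have sub: "U \<subseteq> X closure_of U"
    using U by (simp add: closure_of_subset openin_subset)
  have "\<alpha> s \<in> \<alpha> ` {s..t}" "\<alpha> t \<in> \<alpha> ` {s..t}"
    using st by auto
  then have "\<alpha> ` {s..t} \<inter> U \<noteq> {}" "\<alpha> ` {s..t} - U \<noteq> {}"
    using ends sub by blast+
  then have "\<alpha> ` {s..t} \<inter> X frontier_of U \<noteq> {}"
    by (rule connectedin_Int_frontier_of[OF conn])
  then obtain r where r: "s \<le> r" "r \<le> t" "\<alpha> r \<in> X frontier_of U"
    by auto
  moreover have "r \<noteq> s" "r \<noteq> t"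
    using r(3) ends U by (auto simp: frontier_of_def interior_of_openin)
  ultimately show ?thesis
    by (intro exI[of _ r]) auto
qed

lemma arc_in_inj_on:
  assumes "arc_in X \<alpha>"
  shows "inj_on \<alpha> {0..1}"
  using assms by (simp add: arc_in_def embedding_map_def homeomorphic_eq_everything_map)

text \<open>With \<open>n = card (X frontier_of U) + 2\<close> alternating points there are \<open>n - 1\<close> crossings, one
  more than the boundary can accommodate.\<close>

lemma not_n_sac_if_finite_frontier:
  assumes conn: "connected_space X" and t1: "t1_space X"
    and U: "openin X U" "U \<noteq> {}" "X closure_of U \<noteq> topspace X"
    and fin: "finite (X frontier_of U)"
  shows "\<not> n_sac (card (X frontier_of U) + 2) X"
proof
  define V where "V = topspace X - X closure_of U"
  define n where "n = card (X frontier_of U) + 2"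
  assume "n_sac (card (X frontier_of U) + 2) X"
  then have sac: "n_sac n X"
    by (simp add: n_def)
  have sub: "U \<subseteq> X closure_of U" "U \<subseteq> topspace X" "X closure_of U \<subseteq> topspace X"
    using U by (auto simp: closure_of_subset openin_subset closure_of_subset_topspace)
  have V: "openin X V" "V \<noteq> {}" "V \<inter> U = {}" "V \<subseteq> topspace X"
    using U(3) sub by (auto simp: V_def)
  have "U \<noteq> topspace X" "V \<noteq> topspace X"
    using U V sub by blast+
  then have "infinite U" "infinite V"
    using U V by (simp_all add: infinite_openin_connected_t1[OF conn t1])
  then obtain f g :: "nat \<Rightarrow> 'a"
    where f: "inj f" "range f \<subseteq> U" and g: "inj g" "range g \<subseteq> V"
    by (meson infinite_countable_subset)
  define x where "x i = (if even i then f i else g i)" for i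
  have xU: "x i \<in> U" if "even i" for i
    using f that by (auto simp: x_def)
  have xV: "x i \<in> V" if "odd i" for i
    using g that by (auto simp: x_def)
  have "inj x"
  proof (rule injI)
    fix i j assume "x i = x j"
    moreover from this have "even i \<longleftrightarrow> even j"
      using xU xV V(3) by (metis disjoint_iff)
    ultimately show "i = j"
      using f(1) g(1) by (auto simp: x_def inj_eq split: if_splits)
  qed
  then have "inj_on x {1..n}"
    by (rule inj_on_subset) simp
  moreover have "x i \<in> topspace X" for i
    using xU[of i] xV[of i] sub(2) V(4) by blast
  then have "x ` {1..n} \<subseteq> topspace X"
    by blast
  ultimately obtain \<alpha> t where arc: "arc_in X \<alpha>" and t: "t ` {1..n} \<subseteq> {0..1}"
    and mono: "strict_mono_on {1..n} t" and \<alpha>t: "\<And>i. i \<in> {1..n} \<Longrightarrow> \<alpha> (t i) = x i"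
    using sac[unfolded n_sac_def, rule_format, of x] by auto
  have "\<exists>r. t i < r \<and> r < t (Suc i) \<and> \<alpha> r \<in> X frontier_of U" if i: "i \<in> {1..<n}" for i
  proof (rule arc_in_crosses_frontier[OF arc _ _ _ U(1)])
    have dom: "i \<in> {1..n}" "Suc i \<in> {1..n}"
      using i by auto
    then have "t i \<in> {0..1}" "t (Suc i) \<in> {0..1}"
      using t by blast+
    then show "0 \<le> t i" "t (Suc i) \<le> 1"
      by auto
    show "t i < t (Suc i)"
      using strict_mono_onD[OF mono dom] by simp
    show "\<alpha> (t i) \<in> U \<and> \<alpha> (t (Suc i)) \<in> topspace X - X closure_of U \<or>
       \<alpha> (t (Suc i)) \<in> U \<and> \<alpha> (t i) \<in> topspace X - X closure_of U"
      using xU[of i] xV[of i] xU[of "Suc i"] xV[of "Suc i"]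
      by (cases "even i") (simp_all add: \<alpha>t[OF dom(1)] \<alpha>t[OF dom(2)] V_def)
  qed
  then obtain r where r: "t i < r i" "r i < t (Suc i)" "\<alpha> (r i) \<in> X frontier_of U"
    if "i \<in> {1..<n}" for i
    by metis
  have r_less: "r i < r j" if "i \<in> {1..<n}" "j \<in> {1..<n}" "i < j" for i j
  proof -
    have "t (Suc i) \<le> t j"
      using mono that by (intro strict_mono_on_leD[OF mono]) auto
    then show ?thesis
      using r(2)[OF that(1)] r(1)[OF that(2)] by linarith
  qed
  have "inj_on r {1..<n}"
    by (rule linorder_inj_onI') (use r_less in fastforce)
  moreover have "r ` {1..<n} \<subseteq> {0..1}"
  proof (intro image_subsetI)
    fix i assume i: "i \<in> {1..<n}"
    then have "t i \<in> {0..1}" "t (Suc i) \<in> {0..1}"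
      using t by (auto simp: image_subset_iff)
    then show "r i \<in> {0..1}"
      using r(1,2)[OF i] by auto
  qed
  ultimately have "inj_on (\<alpha> \<circ> r) {1..<n}"
    using inj_on_subset[OF arc_in_inj_on[OF arc]] by (intro comp_inj_on)
  moreover have "(\<alpha> \<circ> r) ` {1..<n} \<subseteq> X frontier_of U"
    using r(3) by auto
  ultimately have "card {1..<n} \<le> card (X frontier_of U)"
    using fin by (rule card_inj_on_le)
  then show False
    by (simp add: n_def)
qed

theorem mainTheorem8:
  fixes M :: "'a metric"
  assumes "regular_continuum M" and "nondegenerate M"
  shows "\<not> omega_sac (mtopology_of M)"
proof -
  let ?X = "mtopology_of M"
  have haus: "Hausdorff_space ?X"
    by (simp add: mtopology_of_def Metric_space.Hausdorff_space_mtopology)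
  obtain \<B> where conn: "connected_space ?X" and base: "is_base ?X \<B>"
    and fin: "\<And>B. B \<in> \<B> \<Longrightarrow> finite (?X frontier_of B)"
    using assms(1) unfolding regular_continuum_def continuum_def by blast
  obtain x y where "x \<in> topspace ?X" "y \<in> topspace ?X" "x \<noteq> y"
    using assms(2) by (auto simp: nondegenerate_def)
  then obtain P Q where PQ: "openin ?X P" "openin ?X Q" "x \<in> P" "y \<in> Q" "disjnt P Q"
    using haus unfolding Hausdorff_space_def by metis
  then obtain B where B: "B \<in> \<B>" "x \<in> B" "B \<subseteq> P" "openin ?X B"
    using base unfolding is_base_def by (metis Union_iff Union_upper subsetD)
  have "Q \<inter> ?X closure_of B = {}"
    using PQ B openin_Int_closure_of_eq_empty[OF PQ(2), of B] by (auto simp: disjnt_def)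
  then have "?X closure_of B \<noteq> topspace ?X"
    using PQ(2,4) openin_subset by fastforce
  then have "\<not> n_sac (card (?X frontier_of B) + 2) ?X"
    using B by (intro not_n_sac_if_finite_frontier conn Hausdorff_imp_t1_space haus fin) auto
  then show ?thesis
    unfolding omega_sac_def using le_add2 by blast
qed

end
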